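(* Let $G(s)=C(sI-A)^{-1}B$ be a stable system, with real matrices $A\in\mathbb R^{n\times n}$, $B\in\mathbb R^{n\times m_w}$, $C\in\mathbb R^{p_z\times n}$. Then $$\overline{\sigma}(CB)\;\leq\;\mathcal K(G)\;\leq\;\mathcal M_0(G).$$
   Context: $\overline{\sigma}(M)$ denotes the maximum singular value of a matrix $M$. Stable means that all eigenvalues of $A$ have negative real part. $\mathcal K(G):=\sup_{\mathrm{Re}(s)>0}\mathrm{Re}(s)\,\overline{\sigma}(C(sI-A)^{-1}B)$, with supremum over complex $s$ with $\mathrm{Re}(s)>0$, and $\mathcal M_0(G):=\sup_{t\geq 0}\overline{\sigma}(Ce^{At}B)$. *)

theory Defs
  imports "HOL-Analysis.Analysis"
begin

abbreviation complexify :: "real^'n^'m \<Rightarrow> complex^'n^'m" where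
  "complexify \<equiv> map_matrix complex_of_real"

definition conj_transpose :: "complex^'n^'m \<Rightarrow> complex^'m^'n" where
  "conj_transpose M = (\<chi> i j. cnj (M $ j $ i))"

definition eigenvalue :: "complex^'n^'n \<Rightarrow> complex \<Rightarrow> bool" where
  "eigenvalue M l \<longleftrightarrow> (\<exists>v. v \<noteq> 0 \<and> M *v v = l *s v)"

text \<open>
  The singular values are the nonnegative square roots of the eigenvalues of the Gram matrix
  \<open>M\<^sup>* M\<close>. This is a finite nonempty set. For a matrix with more columns than rows it may
  contain an additional 0, which does not affect the maximum.
\<close>

definition singular_values :: "complex^'n^'m \<Rightarrow> real set" where
  "singular_values M =
     {x. 0 \<le> x \<and> eigenvalue (conj_transpose M ** M) (complex_of_real (x\<^sup>2))}"

definition max_singular_value :: "complex^'n^'m \<Rightarrow> real" where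
  "max_singular_value M = Max (singular_values M)"

definition stable_matrix :: "real^'n^'n \<Rightarrow> bool" where
  "stable_matrix A \<longleftrightarrow> (\<forall>l. eigenvalue (complexify A) l \<longrightarrow> Re l < 0)"

primrec mat_pow :: "real^'n^'n \<Rightarrow> nat \<Rightarrow> real^'n^'n" where
  "mat_pow A 0 = mat 1"
| "mat_pow A (Suc k) = A ** mat_pow A k"

text \<open>
  The library function \<open>exp\<close> and the power operator do not apply here, because the
  multiplication \<open>*\<close> on type \<open>vec\<close> is componentwise.
\<close>

definition mat_exp :: "real^'n^'n \<Rightarrow> real^'n^'n" where
  "mat_exp A = (\<Sum>k. (1 / fact k) *\<^sub>R mat_pow A k)"

text \<open>
  In the next definition \<open>mat s\<close> is the scalar matrix with \<open>s\<close> on the diagonal. The value of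
  \<open>matrix_inv\<close> is meaningful whenever \<open>s\<close> is not an eigenvalue of \<open>A\<close>, so for stable \<open>A\<close> on
  the whole open right half-plane.
\<close>

definition transfer_function ::
  "real^'n^'n \<Rightarrow> real^'m^'n \<Rightarrow> real^'n^'p \<Rightarrow> complex \<Rightarrow> complex^'m^'p" where
  "transfer_function A B C s =
     complexify C ** matrix_inv (mat s - complexify A) ** complexify B"

text \<open>
  Both suprema are taken in the extended reals, so that they are genuine least upper bounds
  without a boundedness side condition.
\<close>

definition kreiss_constant :: "(complex \<Rightarrow> complex^'m^'p) \<Rightarrow> ereal" where
  "kreiss_constant G = (SUP s\<in>{s. Re s > 0}. ereal (Re s * max_singular_value (G s)))"

definition max_transient_growth ::
  "real^'n^'n \<Rightarrow> real^'m^'n \<Rightarrow> real^'n^'p \<Rightarrow> ereal" where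
  "max_transient_growth A B C =
     (SUP t\<in>{0..}. ereal (max_singular_value (complexify (C ** mat_exp (t *\<^sub>R A) ** B))))"

end

theory Submission
  imports Defs
    "HOL-Computational_Algebra.Fundamental_Theorem_Algebra"
begin

text \<open>
  The maximum singular value is the operator norm for the Hermitian norm. For \<open>Re s > 0\<close> put
  \<open>r = (s - A)\<^sup>-\<^sup>1 B w\<close>; the function \<open>t \<mapsto> exp (- s t) C exp (t A) r\<close> starts at \<open>G s w\<close>, tends to 0,
  and has derivative \<open>- exp (- s t) C exp (t A) B w\<close>, which yields \<open>Re s \<cdot> \<sigma>(G s) \<le> M\<^sub>0\<close>. Since
  \<open>s (s - A)\<^sup>-\<^sup>1 = 1 + A (s - A)\<^sup>-\<^sup>1\<close>, we have \<open>s G s \<rightarrow> C B\<close> for real \<open>s \<rightarrow> \<infinity>\<close>, which is the other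
  inequality. The decay at infinity needs bounded orbits of \<open>exp (t A)\<close>: every vector is
  annihilated by a nonzero polynomial in \<open>A\<close>, and its linear factors \<open>A - l\<close> can be removed one
  at a time, because a bounded orbit of \<open>(A - l) v\<close> forces a bounded orbit of \<open>v\<close>.
\<close>

section \<open>The maximum singular value as an operator norm\<close>

lemma of_real_vector_smult: "complex_of_real a *s v = a *\<^sub>R v"
  unfolding vec_eq_iff by (auto simp add: complex_eq_iff)

text \<open>On complex vectors \<open>inner\<close> is the real part of the Hermitian form, so the
  conjugate transpose is an adjoint for it as well, and real inner products suffice below.\<close>

lemma inner_conj_transpose_mult:
  fixes M :: "complex^'n^'m"
  shows "inner (conj_transpose M *v w) v = inner w (M *v v)"
proof -
  have *: "inner (cnj m * a) b = inner a (m * b)" for m a b :: complex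
    by (simp add: inner_complex_def algebra_simps)
  have "inner (conj_transpose M *v w) v = (\<Sum>i\<in>UNIV. \<Sum>j\<in>UNIV. inner (w $ j) (M $ j $ i * v $ i))"
    by (simp add: matrix_vector_mult_def inner_vec_def conj_transpose_def inner_sum_left *)
  also have "\<dots> = inner w (M *v v)"
    by (subst sum.swap) (simp add: matrix_vector_mult_def inner_vec_def inner_sum_right)
  finally show ?thesis .
qed

lemma norm_mult_le_onorm:
  fixes M :: "complex^'n^'m"
  shows "norm (M *v v) \<le> onorm ((*v) M) * norm v"
  by (rule onorm[OF matrix_vector_mul_bounded_linear])

lemma onorm_matrix_nonneg: "0 \<le> onorm ((*v) (M :: complex^'n^'m))"
  by (rule onorm_pos_le[OF matrix_vector_mul_bounded_linear])

text \<open>Pairing the image of \<open>w\<close> with itself and moving the adjoint across gives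
  its squared norm; Cauchy-Schwarz then leaves one factor to cancel.\<close>

lemma norm_conj_transpose_mult_le:
  fixes M :: "complex^'n^'m"
  shows "norm (conj_transpose M *v w) \<le> onorm ((*v) M) * norm w"
proof (cases "conj_transpose M *v w = 0")
  case False
  let ?u = "conj_transpose M *v w"
  have "(norm ?u)\<^sup>2 = inner w (M *v ?u)"
    by (simp add: power2_norm_eq_inner inner_conj_transpose_mult)
  also have "\<dots> \<le> norm w * norm (M *v ?u)"
    by (rule norm_cauchy_schwarz)
  also have "\<dots> \<le> norm w * (onorm ((*v) M) * norm ?u)"
    by (intro mult_left_mono norm_mult_le_onorm) auto
  finally have "norm ?u * norm ?u \<le> (onorm ((*v) M) * norm w) * norm ?u"
    by (simp add: power2_eq_square mult_ac)
  with False show ?thesis by (simp add: mult_le_cancel_right)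
qed (simp add: onorm_matrix_nonneg)

lemma gram_eigenvector_iff:
  fixes M :: "complex^'n^'m"
  shows "eigenvalue (conj_transpose M ** M) (complex_of_real a) \<longleftrightarrow>
    (\<exists>v. v \<noteq> 0 \<and> conj_transpose M *v (M *v v) = a *\<^sub>R v)"
  by (simp add: eigenvalue_def of_real_vector_smult matrix_vector_mul_assoc)

text \<open>Eigenvectors of the self-adjoint Gram matrix for different eigenvalues are orthogonal,
  and orthogonal families are finite. Finiteness makes \<open>Max\<close> in
  \<open>max_singular_value\<close> meaningful.\<close>

lemma finite_singular_values:
  fixes M :: "complex^'n^'m"
  shows "finite (singular_values M)"
proof -
  let ?S = "\<lambda>v. conj_transpose M *v (M *v v)"
  have "\<forall>x\<in>singular_values M. \<exists>v. v \<noteq> 0 \<and> ?S v = x\<^sup>2 *\<^sub>R v"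
    by (simp add: singular_values_def gram_eigenvector_iff del: of_real_power)
  then obtain e where e: "\<And>x. x \<in> singular_values M \<Longrightarrow> e x \<noteq> 0 \<and> ?S (e x) = x\<^sup>2 *\<^sub>R e x"
    by metis
  have orth: "inner (e x) (e y) = 0"
    if x: "x \<in> singular_values M" and y: "y \<in> singular_values M" and "x \<noteq> y" for x y
  proof -
    have "x\<^sup>2 * inner (e x) (e y) = inner (?S (e x)) (e y)"
      using e[OF x] by simp
    also have "\<dots> = inner (e x) (?S (e y))"
      by (metis inner_commute inner_conj_transpose_mult)
    also have "\<dots> = y\<^sup>2 * inner (e x) (e y)"
      using e[OF y] by simp
    finally have "x\<^sup>2 = y\<^sup>2 \<or> inner (e x) (e y) = 0" by auto
    moreover have "0 \<le> x" "0 \<le> y" using x y by (auto simp: singular_values_def)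
    ultimately show ?thesis using \<open>x \<noteq> y\<close> by (simp add: power2_eq_iff_nonneg)
  qed
  \<comment> \<open>An eigenvector shared by two singular values would be orthogonal to itself,
    hence 0.\<close>
  have "inj_on e (singular_values M)"
    by (rule inj_onI) (metis e inner_eq_zero_iff orth)
  moreover have "finite (e ` singular_values M)"
    by (rule pairwise_orthogonal_imp_finite)
      (auto simp: pairwise_def orthogonal_def intro: orth)
  ultimately show ?thesis by (rule finite_imageD[rotated])
qed

text \<open>Compactness of the unit sphere yields a maximiser, and scaling extends its bound to all
  vectors.\<close>

lemma onorm_attained:
  fixes M :: "complex^'n^'m"
  obtains v where "norm v = 1" "norm (M *v v) = onorm ((*v) M)"
proof -
  have "sphere 0 1 \<noteq> ({} :: (complex^'n) set)"
    by simp
  moreover have "continuous_on (sphere 0 1) (\<lambda>v. norm (M *v v))"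
    by (intro continuous_on_norm linear_continuous_on matrix_vector_mul_bounded_linear)
  ultimately obtain v where v: "norm v = 1" and max: "\<And>w. norm w = 1 \<Longrightarrow> norm (M *v w) \<le> norm (M *v v)"
    using continuous_attains_sup[of "sphere 0 1" "\<lambda>v. norm (M *v v)"] by auto
  have "onorm ((*v) M) \<le> norm (M *v v)"
  proof (rule onorm_bound)
    fix x :: "complex^'n"
    show "norm (M *v x) \<le> norm (M *v v) * norm x"
    proof (cases "x = 0")
      case False
      then have "norm (M *v ((1 / norm x) *\<^sub>R x)) \<le> norm (M *v v)"
        by (intro max) simp
      moreover have "M *v ((1 / norm x) *\<^sub>R x) = (1 / norm x) *\<^sub>R (M *v x)"
        by (rule linear_cmul) simp
      ultimately show ?thesis using False by (simp add: field_simps)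
    qed simp
  qed simp
  with norm_mult_le_onorm[of M v] v show ?thesis by (intro that) auto
qed

text \<open>An eigenvector for a singular value is stretched by exactly that factor, so the operator
  norm is an upper bound. It is itself a singular value because a maximiser on the unit sphere is an
  eigenvector of the Gram matrix.\<close>

lemma max_singular_value_eq_onorm:
  fixes M :: "complex^'n^'m"
  shows "max_singular_value M = onorm ((*v) M)"
  unfolding max_singular_value_def
proof (rule Max_eqI)
  let ?\<sigma> = "onorm ((*v) M)"
  show "finite (singular_values M)" by (rule finite_singular_values)
  show "x \<le> ?\<sigma>" if "x \<in> singular_values M" for x
  proof -
    from that obtain v where "0 \<le> x" "v \<noteq> 0" and v: "conj_transpose M *v (M *v v) = x\<^sup>2 *\<^sub>R v"
      by (auto simp: singular_values_def gram_eigenvector_iff simp del: of_real_power)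
    have "(x * norm v)\<^sup>2 = inner (conj_transpose M *v (M *v v)) v"
      by (simp add: v power_mult_distrib power2_norm_eq_inner)
    also have "\<dots> = (norm (M *v v))\<^sup>2"
      by (simp add: inner_conj_transpose_mult power2_norm_eq_inner)
    finally have "x * norm v = norm (M *v v)"
      using \<open>0 \<le> x\<close> by (simp add: power2_eq_iff_nonneg)
    with norm_mult_le_onorm[of M v] have "x * norm v \<le> ?\<sigma> * norm v" by simp
    with \<open>v \<noteq> 0\<close> show ?thesis by simp
  qed
  show "?\<sigma> \<in> singular_values M"
  proof -
    obtain v where v: "norm v = 1" "norm (M *v v) = ?\<sigma>" by (rule onorm_attained)
    let ?w = "conj_transpose M *v (M *v v)"
    have inner: "inner ?w v = ?\<sigma>\<^sup>2"
      by (simp add: inner_conj_transpose_mult v flip: power2_norm_eq_inner)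
    have "norm ?w \<le> ?\<sigma>\<^sup>2"
      using norm_conj_transpose_mult_le[of M "M *v v"] v by (simp add: power2_eq_square)
    then have "(norm ?w)\<^sup>2 \<le> (?\<sigma>\<^sup>2)\<^sup>2" by (intro power_mono) auto
    \<comment> \<open>For the unit vector \<open>v\<close> the right side is at most \<sigma>^4 - 2
      \<sigma>^4 + \<sigma>^4 = 0, which forces the eigenvector equation.\<close>
    moreover have "(norm (?w - ?\<sigma>\<^sup>2 *\<^sub>R v))\<^sup>2 = (norm ?w)\<^sup>2 - 2 * ?\<sigma>\<^sup>2 * inner ?w v + (?\<sigma>\<^sup>2)\<^sup>2 * (norm v)\<^sup>2"
      unfolding power2_norm_eq_inner by (simp add: inner_diff inner_commute power2_eq_square algebra_simps)
    ultimately have "(norm (?w - ?\<sigma>\<^sup>2 *\<^sub>R v))\<^sup>2 \<le> 0"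
      using v inner by (simp add: power2_eq_square)
    then have "?w = ?\<sigma>\<^sup>2 *\<^sub>R v" by simp
    moreover have "v \<noteq> 0" using v by auto
    ultimately show ?thesis
      by (auto simp: singular_values_def gram_eigenvector_iff onorm_matrix_nonneg simp del: of_real_power)
  qed
qed

section \<open>The matrix exponential\<close>

lemma mat_pow_commute: "mat_pow A k ** A = A ** mat_pow A k"
  by (induction k) (simp_all flip: matrix_mul_assoc)

lemma mat_pow_scaleR: "mat_pow (t *\<^sub>R A) k = t ^ k *\<^sub>R mat_pow A k"
  by (induction k) (simp_all add: matrix_scalar_ac mult.commute flip: scalar_matrix_assoc)

text \<open>Submultiplicativity of the operator norm, read off on the columns of the power, lets
  each entry of the exponential series be compared with a scalar exponential series.\<close>

lemma mat_pow_component_bound: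
  fixes A :: "real^'n^'n"
  obtains c where "\<And>k i j. \<bar>mat_pow A k $ i $ j\<bar> \<le> c ^ k"
proof
  fix k i j
  let ?c = "onorm ((*v) A)"
  have "norm (mat_pow A k *v x) \<le> ?c ^ k * norm x" for x :: "real^'n"
  proof (induction k)
    case (Suc k)
    have "norm (mat_pow A (Suc k) *v x) \<le> ?c * norm (mat_pow A k *v x)"
      by (simp flip: matrix_vector_mul_assoc add: onorm[OF matrix_vector_mul_bounded_linear])
    also have "\<dots> \<le> ?c * (?c ^ k * norm x)"
      by (intro mult_left_mono Suc onorm_pos_le matrix_vector_mul_bounded_linear)
    finally show ?case by (simp add: mult_ac)
  qed simp
  from this[of "axis j 1"] have "norm (mat_pow A k *v axis j 1) \<le> ?c ^ k" by simp
  moreover have "mat_pow A k $ i $ j = (mat_pow A k *v axis j 1) $ i"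
    by (simp add: matrix_vector_mult_basis column_def)
  ultimately show "\<bar>mat_pow A k $ i $ j\<bar> \<le> ?c ^ k"
    using component_le_norm_cart[of "mat_pow A k *v axis j 1" i] by linarith
qed

text \<open>Each entry is written as a power series in \<open>t\<close>, the form that termwise
  differentiation requires.\<close>

lemma summable_mat_exp_component:
  fixes A :: "real^'n^'n"
  shows "summable (\<lambda>k. mat_pow A k $ i $ j / fact k * t ^ k)"
proof -
  obtain c where c: "\<And>k i j. \<bar>mat_pow A k $ i $ j\<bar> \<le> c ^ k"
    using mat_pow_component_bound[of A] by blast
  show ?thesis
  proof (rule summable_comparison_test')
    show "summable (\<lambda>k. inverse (fact k) * (c * \<bar>t\<bar>) ^ k)" by (rule summable_exp)
    show "norm (mat_pow A k $ i $ j / fact k * t ^ k) \<le> inverse (fact k) * (c * \<bar>t\<bar>) ^ k" for k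
      using c[of k i j] by (simp add: abs_mult power_abs power_mult_distrib divide_simps mult_right_mono)
  qed
qed

lemma sums_matI:
  fixes f :: "nat \<Rightarrow> real^'n^'m"
  assumes "\<And>i j. (\<lambda>k. f k $ i $ j) sums (S $ i $ j)"
  shows "f sums S"
  using assms unfolding sums_def by (intro vec_tendstoI) (simp add: sum_component)

text \<open>\<open>mat_exp\<close> is a bare infinite sum; this supplies its convergence, with the
  powers of \<open>t\<close> pulled out of the matrix powers.\<close>

lemma mat_exp_sums:
  fixes A :: "real^'n^'n"
  shows "(\<lambda>k. (t ^ k / fact k) *\<^sub>R mat_pow A k) sums mat_exp (t *\<^sub>R A)"
proof -
  have "(\<lambda>k. (1 / fact k) *\<^sub>R mat_pow (t *\<^sub>R A) k) sums
      (\<chi> i j. \<Sum>k. mat_pow A k $ i $ j / fact k * t ^ k)"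
    using summable_sums[OF summable_mat_exp_component[of A _ _ t]]
    by (intro sums_matI) (simp add: mat_pow_scaleR mult_ac)
  then show ?thesis unfolding mat_exp_def by (simp add: sums_iff mat_pow_scaleR)
qed

lemma sums_mat_component:
  fixes f :: "nat \<Rightarrow> real^'n^'m"
  assumes "f sums S"
  shows "(\<lambda>k. f k $ i $ j) sums (S $ i $ j)"
  using bounded_linear.sums[OF bounded_linear_compose[OF bounded_linear_vec_nth[of j]
      bounded_linear_vec_nth[of i]] assms]
  by simp

lemma mat_exp_0: "mat_exp (0 *\<^sub>R A) = mat 1"
proof -
  have "(\<lambda>k. (0 ^ k / fact k) *\<^sub>R mat_pow A k) sums (\<Sum>k\<in>{0}. (0 ^ k / fact k) *\<^sub>R mat_pow A k)"
    by (rule sums_finite) (auto simp: power_0_left)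
  with mat_exp_sums[of 0 A] have "mat_exp (0 *\<^sub>R A) = (\<Sum>k\<in>{0}. (0 ^ k / fact k) *\<^sub>R mat_pow A k)"
    by (rule sums_unique2)
  then show ?thesis by simp
qed

lemma bounded_linear_matrix_mult_left: "bounded_linear (\<lambda>X :: real^'n^'m. X ** B)"
  and bounded_linear_matrix_mult_right: "bounded_linear (\<lambda>X :: real^'m^'k. C ** X)"
  by (auto simp: matrix_add_ldistrib matrix_scalar_ac scalar_matrix_assoc
      matrix_matrix_mult_def vec_eq_iff sum.distrib sum_distrib_left algebra_simps
      simp flip: linear_conv_bounded_linear intro!: linearI)

lemma mat_exp_mult_sums:
  "(\<lambda>k. (t ^ k / fact k) *\<^sub>R (A ** mat_pow A k)) sums (A ** mat_exp (t *\<^sub>R A))"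
  using bounded_linear.sums[OF bounded_linear_matrix_mult_right[of A] mat_exp_sums[of t A]]
  by (simp add: matrix_scalar_ac scalar_matrix_assoc)

text \<open>Both products are sums of the same series, since \<open>A\<close> commutes with its
  powers.\<close>

lemma mat_exp_commute: "mat_exp (t *\<^sub>R A) ** A = A ** mat_exp (t *\<^sub>R A)"
proof -
  have "(\<lambda>k. (t ^ k / fact k) *\<^sub>R (A ** mat_pow A k)) sums (mat_exp (t *\<^sub>R A) ** A)"
    using bounded_linear.sums[OF bounded_linear_matrix_mult_left[of A] mat_exp_sums[of t A]]
    by (simp add: mat_pow_commute flip: scalar_matrix_assoc)
  then show ?thesis using mat_exp_mult_sums by (rule sums_unique2)
qed

text \<open>The component type is general so that the rule applies twice to a matrix, first to rows
  and then to entries.\<close>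

lemma has_vector_derivative_vecI:
  fixes f :: "real \<Rightarrow> 'a::euclidean_space^'n"
  assumes "\<And>i. ((\<lambda>t. f t $ i) has_vector_derivative f' $ i) (at t within S)"
  shows "(f has_vector_derivative f') (at t within S)"
  unfolding has_vector_derivative_def
proof (subst has_derivative_componentwise_within, intro ballI)
  fix b :: "'a^'n" assume "b \<in> Basis"
  then obtain i u where b: "b = axis i u" by (auto simp: Basis_vec_def)
  have "((\<lambda>t. f t $ i \<bullet> u) has_derivative (\<lambda>h. (h *\<^sub>R f' $ i) \<bullet> u)) (at t within S)"
    using assms[of i] unfolding has_vector_derivative_def
    by (rule has_derivative_inner_left)
  then show "((\<lambda>t. f t \<bullet> b) has_derivative (\<lambda>h. (h *\<^sub>R f') \<bullet> b)) (at t within S)"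
    by (simp add: b inner_axis)
qed

lemma mat_exp_has_vector_derivative:
  fixes A :: "real^'n^'n"
  shows "((\<lambda>t. mat_exp (t *\<^sub>R A)) has_vector_derivative A ** mat_exp (t *\<^sub>R A)) (at t)"
proof (intro has_vector_derivative_vecI)
  fix i j
  \<comment> \<open>The factor k + 1 from differentiation cancels against (k + 1)!, which leaves the
    entry of A^(k+1) over k!.\<close>
  have "diffs (\<lambda>k. mat_pow A k $ i $ j / fact k) = (\<lambda>k. (A ** mat_pow A k) $ i $ j / fact k)"
    by (auto simp: diffs_def fun_eq_iff)
  moreover have "(\<lambda>k. (A ** mat_pow A k) $ i $ j / fact k * t ^ k) sums (A ** mat_exp (t *\<^sub>R A)) $ i $ j"
    using sums_mat_component[OF mat_exp_mult_sums, of t A i j] by (simp add: mult_ac)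
  moreover have "mat_exp (t *\<^sub>R A) $ i $ j = (\<Sum>k. mat_pow A k $ i $ j / fact k * t ^ k)" for t
    using sums_mat_component[OF mat_exp_sums, of t A i j] by (simp add: mult_ac sums_iff)
  ultimately show "((\<lambda>t. mat_exp (t *\<^sub>R A) $ i $ j) has_vector_derivative
      (A ** mat_exp (t *\<^sub>R A)) $ i $ j) (at t)"
    using termdiffs_strong_converges_everywhere[OF summable_mat_exp_component[of A i j], of t]
    by (simp add: has_real_derivative_iff_has_vector_derivative sums_iff)
qed

section \<open>Bounded orbits of stable matrices\<close>

lemma complexify_mult: "complexify (X ** Y) = complexify X ** complexify Y"
  by (simp add: vec_eq_iff matrix_matrix_mult_def)

lemma complexify_mat_1: "complexify (mat 1) = mat 1"
  by (simp add: vec_eq_iff mat_def)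

lemma norm_vector_smult: "norm (c *s v) = cmod c * norm v" for v :: "complex^'n"
  by (simp add: norm_vec_def norm_mult L2_set_right_distrib)

lemma bounded_bilinear_vector_smult:
  "bounded_bilinear ((*s) :: complex \<Rightarrow> complex^'n \<Rightarrow> complex^'n)"
  unfolding bilinear_conv_bounded_bilinear[symmetric] bilinear_def
  by (auto intro!: linearI simp: vec_eq_iff algebra_simps)

text \<open>The exponential is real, but eigenvalues and the frequency \<open>s\<close> are complex,
  so its orbits are taken in complex space.\<close>

definition flow :: "real^'n^'n \<Rightarrow> real \<Rightarrow> complex^'n^'n" where
  "flow A t = complexify (mat_exp (t *\<^sub>R A))"

lemma flow_0: "flow A 0 = mat 1"
  by (simp only: flow_def mat_exp_0 complexify_mat_1)

lemma flow_commute: "flow A t *v (complexify A *v v) = complexify A *v (flow A t *v v)"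
  by (simp add: flow_def matrix_vector_mul_assoc mat_exp_commute flip: complexify_mult)

lemma flow_has_vector_derivative:
  fixes A :: "real^'n^'n"
  shows "((\<lambda>t. flow A t *v v) has_vector_derivative flow A t *v (complexify A *v v)) (at t)"
proof -
  have "bounded_linear (\<lambda>X :: real^'n^'n. complexify X *v v)"
    unfolding linear_conv_bounded_linear[symmetric]
    by (intro linearI) (simp_all add: vec_eq_iff matrix_vector_mult_def sum.distrib sum_distrib_left
        algebra_simps scaleR_conv_of_real[where 'a = complex])
  from bounded_linear.has_vector_derivative[OF this mat_exp_has_vector_derivative, of A t]
  show ?thesis
    by (simp add: flow_def complexify_mult matrix_vector_mul_assoc mat_exp_commute flip: complexify_mult)
qed

text \<open>The curve is exp(t(A + z)) v. Taking \<open>z\<close> to be \<open>- l\<close> or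
  \<open>- s\<close> puts the vector (A - l) v or (A - s) v under the flow.\<close>

lemma exp_smult_flow_has_vector_derivative:
  "((\<lambda>t. exp (t *\<^sub>R z) *s (flow A t *v v)) has_vector_derivative
    exp (t *\<^sub>R z) *s (flow A t *v (complexify A *v v + z *s v))) (at t)"
proof -
  have "((\<lambda>t. exp (t *\<^sub>R z) *s (flow A t *v v)) has_vector_derivative
      exp (t *\<^sub>R z) *s (flow A t *v (complexify A *v v)) + (exp (t *\<^sub>R z) * z) *s (flow A t *v v)) (at t)"
    by (rule bounded_bilinear.has_vector_derivative[OF bounded_bilinear_vector_smult
        exp_scaleR_has_vector_derivative_right flow_has_vector_derivative])
  moreover have "z *s (flow A t *v v) = flow A t *v (z *s v)"
    by (simp add: vector_scalar_commute)
  ultimately show ?thesis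
    by (simp add: matrix_vector_right_distrib vector_add_ldistrib flip: vector_smult_assoc)
qed

text \<open>Mere boundedness, with a constant depending on \<open>v\<close>, is enough: the decay
  later comes from the factor exp(- s t).\<close>

definition bounded_orbit :: "real^'n^'n \<Rightarrow> complex^'n \<Rightarrow> bool" where
  "bounded_orbit A v \<longleftrightarrow> (\<exists>K. \<forall>t\<ge>0. norm (flow A t *v v) \<le> K)"

text \<open>
  The orbit \<open>y\<close> of \<open>v\<close> satisfies \<open>y' - l y = g\<close> with a bounded function \<open>g\<close>, so \<open>exp (- l t) y\<close>
  has derivative of size \<open>O(exp (- Re l t))\<close>.
\<close>

lemma bounded_orbit_eigenvalue:
  assumes "Re l < 0" "bounded_orbit A (complexify A *v v - l *s v)"
  shows "bounded_orbit A v"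
proof -
  define \<mu> where "\<mu> = - Re l"
  have \<mu>: "\<mu> > 0" using assms by (simp add: \<mu>_def)
  obtain K where K: "\<And>t. t \<ge> 0 \<Longrightarrow> norm (flow A t *v (complexify A *v v - l *s v)) \<le> K"
    using assms(2) by (auto simp: bounded_orbit_def)
  define f where "f t = exp (t *\<^sub>R (- l)) *s (flow A t *v v)" for t
  have f: "(f has_vector_derivative exp (t *\<^sub>R (- l)) *s (flow A t *v (complexify A *v v - l *s v))) (at t)" for t
    using exp_smult_flow_has_vector_derivative[of "- l" A v t] by (simp add: f_def[abs_def] vector_smult_lneg)
  \<comment> \<open>This antiderivative of the bound on the derivative of \<open>f\<close> is the
    majorant in the mean value inequality.\<close>
  have \<phi>: "((\<lambda>t. K * exp (\<mu> * t) / \<mu>) has_vector_derivative K * exp (\<mu> * t)) (at t)" for t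
    using \<mu> by (auto simp flip: has_real_derivative_iff_has_vector_derivative intro!: derivative_eq_intros)
  have "K \<ge> 0" using K[of 0] norm_ge_zero order_trans by blast
  have "norm (flow A t *v v) \<le> norm v + K / \<mu>" if "t > 0" for t
  proof -
    have "norm (f t - f 0) \<le> K * exp (\<mu> * t) / \<mu> - K * exp (\<mu> * 0) / \<mu>"
    proof (rule differentiable_bound_general[OF \<open>t > 0\<close> _ _ f \<phi>])
      show "continuous_on {0..t} f"
        by (intro continuous_at_imp_continuous_on ballI has_vector_derivative_continuous[OF f])
      show "continuous_on {0..t} (\<lambda>t. K * exp (\<mu> * t) / \<mu>)"
        by (intro continuous_at_imp_continuous_on ballI has_vector_derivative_continuous[OF \<phi>])
      show "norm (exp (x *\<^sub>R (- l)) *s (flow A x *v (complexify A *v v - l *s v))) \<le> K * exp (\<mu> * x)"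
        if "0 < x" for x
        using K[of x] that by (simp add: norm_vector_smult \<mu>_def mult.commute)
    qed
    moreover have "f 0 = v" by (simp add: f_def flow_0)
    moreover have "norm (f t) \<le> norm (f t - v) + norm v"
      using norm_triangle_ineq[of "f t - v" v] by simp
    ultimately have "norm (f t) \<le> norm v + K * exp (\<mu> * t) / \<mu>"
      using \<open>K \<ge> 0\<close> \<mu> by (smt (verit) divide_nonneg_pos exp_ge_zero mult_nonneg_nonneg)
    also have "norm (f t) = exp (\<mu> * t) * norm (flow A t *v v)"
      by (simp add: f_def norm_vector_smult \<mu>_def mult.commute)
    \<comment> \<open>Giving this summand the same exponential factor lets the factor cancel from
      the whole inequality.\<close>
    also have "norm v \<le> exp (\<mu> * t) * norm v"
      using \<mu> that by (simp add: mult_le_cancel_right1)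
    finally have "exp (\<mu> * t) * norm (flow A t *v v) \<le> exp (\<mu> * t) * (norm v + K / \<mu>)"
      by (simp add: algebra_simps)
    then show ?thesis by simp
  qed
  moreover have "norm (flow A 0 *v v) \<le> norm v + K / \<mu>"
    using \<open>K \<ge> 0\<close> \<mu> by (simp add: flow_0)
  ultimately show ?thesis
    unfolding bounded_orbit_def by (metis order_le_less)
qed

section \<open>Resolvents at points outside the spectrum\<close>

lemma mat_vector_mult: "mat s *v v = s *s v" for v :: "complex^'n"
  by (simp add: vec_eq_iff matrix_vector_mult_def mat_def if_distrib if_distribR cong: if_cong)

text \<open>Off the spectrum \<open>mat s - M\<close> has trivial kernel, so the choice behind
  \<open>matrix_inv\<close> gives a two-sided inverse. The first identity recovers an orbit, the
  second is the equation of a resolvent vector.\<close>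

lemma resolvent_inverse:
  fixes M :: "complex^'n^'n"
  assumes "\<not> eigenvalue M s"
  defines "R \<equiv> matrix_inv (mat s - M)"
  shows "R *v (s *s v - M *v v) = v" and "s *s (R *v v) - M *v (R *v v) = v"
proof -
  have "\<forall>x. (mat s - M) *v x = 0 \<longrightarrow> x = 0"
    using assms(1) by (auto simp: eigenvalue_def matrix_vector_mult_diff_rdistrib mat_vector_mult)
  then have "invertible (mat s - M)"
    by (simp add: invertible_left_inverse matrix_left_invertible_ker)
  then have "R ** (mat s - M) = mat 1" "(mat s - M) ** R = mat 1"
    unfolding R_def matrix_inv_def invertible_def by (metis (mono_tags, lifting) someI_ex)+
  then have "R *v ((mat s - M) *v v) = v" "(mat s - M) *v (R *v v) = v"
    by (simp_all add: matrix_vector_mul_assoc)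
  then show "R *v (s *s v - M *v v) = v" "s *s (R *v v) - M *v (R *v v) = v"
    by (simp_all add: matrix_vector_mult_diff_rdistrib mat_vector_mult)
qed

text \<open>The resolvent at \<open>l\<close> maps the orbit of (A - l) v to minus that of
  \<open>v\<close>. This case arises because a root of an annihilating polynomial need not be an
  eigenvalue.\<close>

lemma bounded_orbit_noneigenvalue:
  assumes l: "\<not> eigenvalue (complexify A) l" and v: "bounded_orbit A (complexify A *v v - l *s v)"
  shows "bounded_orbit A v"
proof -
  obtain K where K: "\<And>t. t \<ge> 0 \<Longrightarrow> norm (flow A t *v (complexify A *v v - l *s v)) \<le> K"
    using v by (auto simp: bounded_orbit_def)
  define R where "R = matrix_inv (mat l - complexify A)"
  have "norm (flow A t *v v) \<le> onorm ((*v) R) * K" if "t \<ge> 0" for t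
  proof -
    let ?u = "flow A t *v (complexify A *v v - l *s v)"
    have "?u = - (l *s (flow A t *v v) - complexify A *v (flow A t *v v))"
      by (simp add: matrix_vector_mult_diff_distrib flow_commute vector_scalar_commute)
    then have "R *v (- ?u) = flow A t *v v"
      using resolvent_inverse(1)[OF l, of "flow A t *v v"] by (simp add: R_def)
    then have "norm (flow A t *v v) \<le> onorm ((*v) R) * norm ?u"
      by (metis norm_mult_le_onorm norm_minus_cancel)
    also have "\<dots> \<le> onorm ((*v) R) * K"
      by (intro mult_left_mono K that onorm_matrix_nonneg)
    finally show ?thesis .
  qed
  then show ?thesis unfolding bounded_orbit_def by blast
qed

section \<open>Polynomials in a matrix applied to a fixed vector\<close>

definition poly_apply :: "complex poly \<Rightarrow> complex^'n^'n \<Rightarrow> complex^'n \<Rightarrow> complex^'n" where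
  "poly_apply p M v = (\<Sum>i\<le>degree p. coeff p i *s (((*v) M ^^ i) v))"

lemma poly_apply_eq:
  assumes "degree p \<le> N"
  shows "poly_apply p M v = (\<Sum>i\<le>N. coeff p i *s (((*v) M ^^ i) v))"
  unfolding poly_apply_def using assms
  by (intro sum.mono_neutral_left) (auto simp: coeff_eq_0)

lemma funpow_matrix_diff_smult:
  fixes M :: "complex^'n^'n"
  shows "((*v) M ^^ i) (v - c *s w) = ((*v) M ^^ i) v - c *s (((*v) M ^^ i) w)"
  by (induction i) (simp_all add: matrix_vector_mult_diff_distrib vector_scalar_commute)

text \<open>Powers of \<open>M\<close> commute with M - l, so a linear factor can be moved onto the
  vector.\<close>

lemma poly_apply_linear_factor:
  "poly_apply ([:- l, 1:] * r) M v = poly_apply r M (M *v v - l *s v)"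
proof -
  let ?q = "[:- l, 1:] * r" and ?m = "\<lambda>i. ((*v) M ^^ i)"
  have deg: "degree ?q \<le> Suc (degree r)"
    by (rule order_trans[OF degree_mult_le]) simp
  \<comment> \<open>Here \<open>pCons 0 r\<close> is X r. Its coefficient at 0 vanishes, so its sum
    shifts by one index; in the other sum the top term vanishes because it lies beyond the degree of
    \<open>r\<close>.\<close>
  have "poly_apply ?q M v = (\<Sum>i\<le>Suc (degree r). (coeff (pCons 0 r) i - l * coeff r i) *s ?m i v)"
    unfolding poly_apply_eq[OF deg] by (intro sum.cong) auto
  also have "\<dots> = (\<Sum>i\<le>Suc (degree r). coeff (pCons 0 r) i *s ?m i v)
      - (\<Sum>i\<le>Suc (degree r). (l * coeff r i) *s ?m i v)"
    by (simp add: sum_subtractf vector_sub_rdistrib del: sum.atMost_Suc)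
  also have "(\<Sum>i\<le>Suc (degree r). coeff (pCons 0 r) i *s ?m i v) = (\<Sum>i\<le>degree r. coeff r i *s ?m i (M *v v))"
    by (subst sum.atMost_Suc_shift) (simp add: funpow_swap1)
  also have "(\<Sum>i\<le>Suc (degree r). (l * coeff r i) *s ?m i v) = (\<Sum>i\<le>degree r. coeff r i *s (l *s ?m i v))"
    by (simp add: coeff_eq_0 mult.commute)
  finally show ?thesis
    by (simp add: poly_apply_def funpow_matrix_diff_smult sum_subtractf del: vector_smult_assoc)
qed

text \<open>\<open>dependent\<close> concerns sets, not families. An injective sequence has an
  infinite, hence dependent, range whose relation pulls back to indices; a repeated value gives a
  relation directly.\<close>

lemma sequence_linear_dependence:
  fixes f :: "nat \<Rightarrow> 'a::euclidean_space"
  obtains N c k where "k \<le> N" "c k \<noteq> 0" "(\<Sum>i\<le>N. c i *\<^sub>R f i) = 0"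
proof (cases "inj f")
  case True
  then have "infinite (range f)" by (simp add: finite_image_iff)
  then have "dependent (range f)" using independent_bound by blast
  then obtain U u w where U: "finite U" "U \<subseteq> range f" "w \<in> U" "u w \<noteq> 0" and sum: "(\<Sum>v\<in>U. u v *\<^sub>R v) = 0"
    unfolding dependent_explicit by blast
  have fin: "finite (f -` U)" by (rule finite_vimageI[OF U(1) True])
  then obtain N where N: "\<And>i. f i \<in> U \<Longrightarrow> i \<le> N"
    by (metis finite_nat_set_iff_bounded_le vimageI)
  obtain k where k: "f k = w" using U by blast
  have "(\<Sum>i\<le>N. (if f i \<in> U then u (f i) else 0) *\<^sub>R f i) = (\<Sum>i\<in>f -` U. u (f i) *\<^sub>R f i)"
    using N by (intro sum.mono_neutral_cong_right) auto
  also have "\<dots> = (\<Sum>v\<in>f ` (f -` U). u v *\<^sub>R v)"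
    by (subst sum.reindex) (auto intro: inj_on_subset[OF True])
  also have "f ` (f -` U) = U" using U(2) by (simp add: image_vimage_eq Int_absorb2)
  finally show ?thesis
    using that[of k N "\<lambda>i. if f i \<in> U then u (f i) else 0"] sum k U N by simp
next
  case False
  then obtain i j where ij: "i \<noteq> j" "f i = f j" by (auto simp: inj_def)
  let ?c = "\<lambda>k. if k = i then 1 else if k = j then - 1 else (0::real)"
  have "(\<Sum>k\<le>i+j. ?c k *\<^sub>R f k) = (\<Sum>k\<in>{i, j}. ?c k *\<^sub>R f k)"
    by (rule sum.mono_neutral_right) auto
  also have "\<dots> = 0" using ij by simp
  finally show ?thesis using that[of i "i + j" ?c] by simp
qed

text \<open>The iterates v, Mv, M^2 v, ... lie in a finite-dimensional real space, so some real
  linear relation holds among them; its coefficients form the polynomial.\<close>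

lemma annihilating_poly:
  fixes v :: "complex^'n"
  obtains p where "p \<noteq> 0" "poly_apply p M v = 0"
proof -
  obtain N c k where k: "k \<le> N" "c k \<noteq> 0" and sum: "(\<Sum>i\<le>N. c i *\<^sub>R ((*v) M ^^ i) v) = 0"
    by (rule sequence_linear_dependence[of "\<lambda>i. ((*v) M ^^ i) v"])
  define p where "p = (\<Sum>i\<le>N. monom (complex_of_real (c i)) i)"
  have coeff: "coeff p i = (if i \<le> N then of_real (c i) else 0)" for i
    by (simp add: p_def coeff_sum)
  have "degree p \<le> N" by (rule degree_le) (simp add: coeff)
  then have "poly_apply p M v = 0"
    using sum by (simp add: poly_apply_eq coeff of_real_vector_smult)
  moreover have "p \<noteq> 0" using k coeff[of k] by auto
  ultimately show ?thesis using that by blast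
qed

lemma bounded_orbit_if_annihilated:
  assumes "stable_matrix A" "p \<noteq> 0" "poly_apply p (complexify A) v = 0"
  shows "bounded_orbit A v"
  using assms(2,3)
proof (induction "degree p" arbitrary: p v)
  case 0
  then have "v = 0"
    using leading_coeff_neq_0[of p] by (auto simp: poly_apply_def vec_eq_iff)
  then show ?case by (auto simp: bounded_orbit_def)
next
  case (Suc n)
  then have "\<not> constant (poly p)" by (simp add: constant_degree)
  then obtain l where "poly p l = 0" using fundamental_theorem_of_algebra by blast
  then obtain r where r: "p = [:- l, 1:] * r" by (metis dvdE poly_eq_0_iff_dvd)
  with Suc.prems have "r \<noteq> 0" by auto
  then have "degree p = Suc (degree r)" unfolding r by (subst degree_mult_eq) auto
  then have "bounded_orbit A (complexify A *v v - l *s v)"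
    using Suc.prems(2) \<open>r \<noteq> 0\<close> Suc.hyps unfolding r poly_apply_linear_factor by simp
  \<comment> \<open>If the root \<open>l\<close> is an eigenvalue, stability gives
    \<open>Re l < 0\<close>; otherwise the resolvent at \<open>l\<close> is available.\<close>
  then show ?case
    using assms(1) bounded_orbit_eigenvalue bounded_orbit_noneigenvalue
    unfolding stable_matrix_def by blast
qed

lemma stable_bounded_orbit:
  assumes "stable_matrix A"
  shows "bounded_orbit A v"
  using annihilating_poly[of "complexify A" v] bounded_orbit_if_annihilated[OF assms] by blast

section \<open>The Kreiss constant\<close>

text \<open>An infinite supremum leaves nothing to prove and nonemptiness excludes minus infinity,
  so only real upper bounds \<open>m\<close> remain to be considered.\<close>

lemma ereal_SUP_upperI:
  fixes f :: "'a \<Rightarrow> real"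
  assumes "I \<noteq> {}" "\<And>m. (\<And>x. x \<in> I \<Longrightarrow> f x \<le> m) \<Longrightarrow> a \<le> m"
  shows "ereal a \<le> (SUP x\<in>I. ereal (f x))"
proof (cases "SUP x\<in>I. ereal (f x)")
  case (real m)
  then have "f x \<le> m" if "x \<in> I" for x
    using SUP_upper[OF that, of "\<lambda>x. ereal (f x)"] by simp
  then show ?thesis using assms(2) real by simp
next
  case MInf
  obtain x where "x \<in> I" using assms(1) by blast
  with MInf show ?thesis using SUP_upper[of x I "\<lambda>x. ereal (f x)"] by simp
qed simp

lemma tendsto_exp_decay:
  fixes a b c :: real
  assumes "a > 0"
  shows "((\<lambda>t. c * (exp (- a * t) * b)) \<longlongrightarrow> 0) at_top"
proof -
  have "filterlim (\<lambda>t. - a * t) at_bot at_top"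
    using assms by (intro filterlim_tendsto_neg_mult_at_bot[OF tendsto_const _ filterlim_ident]) simp
  then have "((\<lambda>t. exp (- a * t)) \<longlongrightarrow> 0) at_top"
    by (rule filterlim_compose[OF exp_at_bot])
  then show ?thesis by (intro tendsto_mult_right_zero tendsto_mult_left_zero)
qed

lemma tendsto_const_div_shift:
  fixes a b c d :: real
  shows "((\<lambda>x. b + c * (a * (d / (x - a)))) \<longlongrightarrow> b) at_top"
proof -
  have "filterlim (\<lambda>x. - a + x) at_top at_top"
    by (rule filterlim_tendsto_add_at_top[OF tendsto_const filterlim_ident])
  then have "((\<lambda>x. d / (x - a)) \<longlongrightarrow> 0) at_top"
    by (intro tendsto_divide_0[OF tendsto_const] filterlim_at_top_imp_at_infinity) simp
  then have "((\<lambda>x. b + c * (a * (d / (x - a)))) \<longlongrightarrow> b + 0) at_top"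
    by (intro tendsto_add tendsto_const tendsto_mult_right_zero)
  then show ?thesis by simp
qed

section \<open>The two inequalities for the transfer function\<close>

lemma transfer_function_mult:
  "transfer_function A B C s *v w =
    complexify C *v (matrix_inv (mat s - complexify A) *v (complexify B *v w))"
  by (simp add: transfer_function_def matrix_vector_mul_assoc matrix_mul_assoc)

text \<open>A mean value inequality takes the place of the Laplace integral of C exp(tA) B: the
  integral of m exp(- Re s t) over the half-line is m / Re s.\<close>

lemma resolvent_bound:
  assumes A: "stable_matrix A" and s: "0 < Re s"
    and m: "\<And>t. 0 \<le> t \<Longrightarrow> max_singular_value (complexify (C ** mat_exp (t *\<^sub>R A) ** B)) \<le> m"
  shows "Re s * max_singular_value (transfer_function A B C s) \<le> m"
proof -
  have nonev: "\<not> eigenvalue (complexify A) s"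
    using A s by (auto simp: stable_matrix_def)
  have m': "norm (complexify C *v (flow A t *v (complexify B *v w))) \<le> m * norm w" if "0 \<le> t" for t w
  proof -
    have "complexify C *v (flow A t *v (complexify B *v w)) = complexify (C ** mat_exp (t *\<^sub>R A) ** B) *v w"
      by (simp add: flow_def matrix_vector_mul_assoc matrix_mul_assoc complexify_mult)
    also have "norm \<dots> \<le> m * norm w"
      using m[OF that] by (intro order_trans[OF norm_mult_le_onorm] mult_right_mono)
        (simp_all add: max_singular_value_eq_onorm)
    finally show ?thesis .
  qed
  have "norm (transfer_function A B C s *v w) \<le> m / Re s * norm w" for w
  proof -
    define r where "r = matrix_inv (mat s - complexify A) *v (complexify B *v w)"
    \<comment> \<open>This equation makes the derivative of \<open>f\<close> involve only the orbit
      of B w, which \<open>m'\<close> controls.\<close>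
    have r: "complexify A *v r - s *s r = - (complexify B *v w)"
      using resolvent_inverse(2)[OF nonev, of "complexify B *v w"] by (simp add: r_def algebra_simps)
    define f where "f t = complexify C *v (exp (t *\<^sub>R (- s)) *s (flow A t *v r))" for t
    define f' where "f' t = complexify C *v (exp (t *\<^sub>R (- s)) *s (flow A t *v (- (complexify B *v w))))" for t
    define \<phi> where "\<phi> t = - (m / Re s * norm w) * exp (- Re s * t)" for t
    have f: "(f has_vector_derivative f' t) (at t)" for t
      unfolding f_def f'_def
      using bounded_linear.has_vector_derivative[OF matrix_vector_mul_bounded_linear
          exp_smult_flow_has_vector_derivative[of "- s" A r t], of "complexify C"] r
      by (simp add: vector_smult_lneg)
    have \<phi>: "(\<phi> has_vector_derivative m * norm w * exp (- Re s * t)) (at t)" for t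
      unfolding \<phi>_def using s
      by (auto simp flip: has_real_derivative_iff_has_vector_derivative intro!: derivative_eq_intros)
    have bound: "norm (f t - f 0) \<le> m / Re s * norm w" if "t > 0" for t
    proof -
      have "norm (f t - f 0) \<le> \<phi> t - \<phi> 0"
      proof (rule differentiable_bound_general[OF \<open>t > 0\<close> _ _ f \<phi>])
        show "continuous_on {0..t} f"
          by (intro continuous_at_imp_continuous_on ballI has_vector_derivative_continuous[OF f])
        show "continuous_on {0..t} \<phi>"
          by (intro continuous_at_imp_continuous_on ballI has_vector_derivative_continuous[OF \<phi>])
        show "norm (f' x) \<le> m * norm w * exp (- Re s * x)" if "0 < x" for x
          using m'[of x w] that
          by (simp add: f'_def vector_scalar_commute norm_vector_smult mult.commute
              linear_neg[OF matrix_vector_mul_linear])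
      qed
      also have "m * norm w \<ge> 0" using m'[of 0 w] order_trans norm_ge_zero by blast
      then have "\<phi> t - \<phi> 0 \<le> m / Re s * norm w" using s by (simp add: \<phi>_def)
      finally show ?thesis .
    qed
    obtain K where K: "\<And>t. 0 \<le> t \<Longrightarrow> norm (flow A t *v r) \<le> K"
      using stable_bounded_orbit[OF A, of r] by (auto simp: bounded_orbit_def)
    have "(f \<longlongrightarrow> 0) at_top"
    proof (rule Lim_null_comparison)
      show "\<forall>\<^sub>F t in at_top. norm (f t) \<le> onorm ((*v) (complexify C)) * (exp (- Re s * t) * K)"
        using eventually_ge_at_top[of 0]
      proof eventually_elim
        case (elim t)
        have "norm (f t) \<le> onorm ((*v) (complexify C)) * norm (exp (t *\<^sub>R (- s)) *s (flow A t *v r))"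
          unfolding f_def by (rule norm_mult_le_onorm)
        also have "\<dots> \<le> onorm ((*v) (complexify C)) * (exp (- Re s * t) * K)"
          using K[OF elim] by (intro mult_left_mono onorm_matrix_nonneg)
            (simp add: norm_vector_smult mult.commute)
        finally show ?case .
      qed
      show "((\<lambda>t. onorm ((*v) (complexify C)) * (exp (- Re s * t) * K)) \<longlongrightarrow> 0) at_top"
        using s by (rule tendsto_exp_decay)
    qed
    \<comment> \<open>Since \<open>f 0\<close> is G(s) w, the bound uniform in \<open>t\<close>
      passes to the limit and bounds G(s) w.\<close>
    then have "((\<lambda>t. norm (f t - f 0)) \<longlongrightarrow> norm (0 - f 0)) at_top"
      by (intro tendsto_intros)
    moreover have "\<forall>\<^sub>F t in at_top. norm (f t - f 0) \<le> m / Re s * norm w"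
      using eventually_gt_at_top[of 0] by eventually_elim (rule bound)
    ultimately have "norm (0 - f 0) \<le> m / Re s * norm w"
      by (rule tendsto_upperbound) simp
    then show ?thesis by (simp add: f_def r_def transfer_function_mult flow_0)
  qed
  then have "max_singular_value (transfer_function A B C s) \<le> m / Re s"
    unfolding max_singular_value_eq_onorm by (rule onorm_le)
  then show ?thesis using s by (simp add: field_simps)
qed

text \<open>For real x > 0 beyond the norm of \<open>A\<close> and r = (x - A)^(-1) B w, the vector
  C B w equals x G(x) w - C A r. The first term is bounded by m |w|, the second is O(1/x).\<close>

lemma high_frequency_bound:
  assumes A: "stable_matrix A"
    and m: "\<And>s. 0 < Re s \<Longrightarrow> Re s * max_singular_value (transfer_function A B C s) \<le> m"
  shows "max_singular_value (complexify (C ** B)) \<le> m"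
  unfolding max_singular_value_eq_onorm
proof (rule onorm_le)
  fix w
  let ?a = "onorm ((*v) (complexify A))" and ?c = "onorm ((*v) (complexify C))"
  define u where "u = complexify B *v w"
  have bound: "norm (complexify (C ** B) *v w) \<le> m * norm w + ?c * (?a * (norm u / (x - ?a)))"
    if x: "x > ?a" for x
  proof -
    have "x > 0" using x onorm_matrix_nonneg[of "complexify A"] by simp
    then have nonev: "\<not> eigenvalue (complexify A) x"
      using A by (auto simp: stable_matrix_def)
    define r where "r = matrix_inv (mat (complex_of_real x) - complexify A) *v u"
    have r: "x *\<^sub>R r = u + complexify A *v r"
      using resolvent_inverse(2)[OF nonev, of u] by (simp add: r_def of_real_vector_smult algebra_simps)
    have "x * norm r = norm (x *\<^sub>R r)" using \<open>x > 0\<close> by simp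
    also have "\<dots> \<le> norm u + norm (complexify A *v r)"
      unfolding r by (rule norm_triangle_ineq)
    also have "\<dots> \<le> norm u + ?a * norm r"
      by (intro add_left_mono norm_mult_le_onorm)
    \<comment> \<open>Because x exceeds the norm of \<open>A\<close>, the term in
      \<open>norm r\<close> on the right can be absorbed on the left.\<close>
    finally have "norm r \<le> norm u / (x - ?a)"
      using x by (simp add: field_simps)
    then have "norm (complexify C *v (complexify A *v r)) \<le> ?c * (?a * (norm u / (x - ?a)))"
      by (intro order_trans[OF norm_mult_le_onorm] mult_left_mono onorm_matrix_nonneg
          order_trans[OF norm_mult_le_onorm])
    moreover have "norm (x *\<^sub>R (complexify C *v r)) \<le> m * norm w"
    proof -
      have "norm (x *\<^sub>R (complexify C *v r)) = x * norm (transfer_function A B C x *v w)"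
        using \<open>x > 0\<close> by (simp add: transfer_function_mult r_def u_def)
      also have "\<dots> \<le> x * (max_singular_value (transfer_function A B C x) * norm w)"
        using \<open>x > 0\<close> norm_mult_le_onorm by (simp add: max_singular_value_eq_onorm)
      also have "\<dots> \<le> m * norm w"
        using m[of x] \<open>x > 0\<close> by (simp add: mult_right_mono flip: mult.assoc)
      finally show ?thesis .
    qed
    moreover have "complexify (C ** B) *v w = x *\<^sub>R (complexify C *v r) - complexify C *v (complexify A *v r)"
    proof -
      have "x *\<^sub>R (complexify C *v r) = complexify C *v (u + complexify A *v r)"
        by (simp add: linear_cmul[OF matrix_vector_mul_linear] flip: r)
      then show ?thesis
        by (simp add: u_def matrix_vector_right_distrib complexify_mult matrix_vector_mul_assoc)
    qed
    ultimately show ?thesis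
      using norm_triangle_ineq4[of "x *\<^sub>R (complexify C *v r)" "complexify C *v (complexify A *v r)"]
      by simp
  qed
  have "((\<lambda>x. m * norm w + ?c * (?a * (norm u / (x - ?a)))) \<longlongrightarrow> m * norm w) at_top"
    by (rule tendsto_const_div_shift)
  moreover have "\<forall>\<^sub>F x in at_top. norm (complexify (C ** B) *v w) \<le> m * norm w + ?c * (?a * (norm u / (x - ?a)))"
    using eventually_gt_at_top[of ?a] by eventually_elim (rule bound)
  ultimately show "norm (complexify (C ** B) *v w) \<le> m * norm w"
    by (rule tendsto_lowerbound) simp
qed

theorem proposition2:
  fixes A :: "real^'n^'n" and B :: "real^'m^'n" and C :: "real^'n^'p"
  assumes "stable_matrix A"
  shows "ereal (max_singular_value (complexify (C ** B))) \<le> kreiss_constant (transfer_function A B C)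
    \<and> kreiss_constant (transfer_function A B C) \<le> max_transient_growth A B C"
proof
  have "{s. 0 < Re s} \<noteq> {}" by (metis Re_complex_of_real empty_iff mem_Collect_eq zero_less_one)
  then show "ereal (max_singular_value (complexify (C ** B))) \<le> kreiss_constant (transfer_function A B C)"
    unfolding kreiss_constant_def
    by (rule ereal_SUP_upperI) (auto intro: high_frequency_bound[OF assms])
  show "kreiss_constant (transfer_function A B C) \<le> max_transient_growth A B C"
    unfolding kreiss_constant_def max_transient_growth_def
    by (intro SUP_least ereal_SUP_upperI) (auto intro: resolvent_bound[OF assms])
qed

end
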